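(* Let $n_o,n_m,p\ge 1$, $n=n_o+n_m$, let $\mathbf{X}_o\in\mathbb{R}^{n_o\times p}$, $\mathbf{X}_m\in\mathbb{R}^{n_m\times p}$ and $\mathbf{Y}_o\in\mathbb{R}^{n_o}$. Consider the regression model with missing responses in which the errors are multivariate normal $\mathrm{MVN}(\mathbf{0},\sigma^2\mathbf{I})$, whose likelihood $L(\boldsymbol\beta,\boldsymbol\beta_m,\sigma)$ is given in the context. Then $\hat{\boldsymbol\beta}_m=\mathbf{X}_m\boldsymbol\beta$ is a maximum likelihood estimate of $\boldsymbol\beta_m$; that is, for every $\boldsymbol\beta\in\mathbb{R}^p$ and every $\sigma>0$, the function $\boldsymbol\beta_m\mapsto L(\boldsymbol\beta,\boldsymbol\beta_m,\sigma)$ on $\mathbb{R}^{n_m}$ attains its maximum at $\boldsymbol\beta_m=\mathbf{X}_m\boldsymbol\beta$.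
   Context: A response variable has $n$ entries, of which $n_o$ are observed (vector $\mathbf{Y}_o$) and $n_m$ are missing. $\mathbf{X}_o$ and $\mathbf{X}_m$ are the (fully known) covariate matrices, possibly including an intercept column of ones, for the observations with observed and missing response, respectively. The missing responses are replaced by zeros, and an indicator column with entry $-1$ is introduced for each missing value, with coefficient vector $\boldsymbol\beta_m\in\mathbb{R}^{n_m}$ (the missing values treated as parameters). The likelihood is $$L(\boldsymbol\beta,\boldsymbol\beta_m,\sigma)=\frac{1}{(2\pi)^{n/2}\sigma^n}\exp\left(-\frac{1}{2\sigma^2}\left\|\begin{pmatrix}\mathbf{Y}_o\\ \mathbf{0}_{n_m}\end{pmatrix}-\begin{pmatrix}\mathbf{X}_o&\mathbf{0}_{n_o\times n_m}\\ \mathbf{X}_m&-\mathbf{I}_{n_m}\end{pmatrix}\begin{pmatrix}\boldsymbol\beta\\ \boldsymbol\beta_m\end{pmatrix}\right\|^2\right),$$ where $\|\cdot\|$ is the Euclidean norm, $\boldsymbol\beta\in\mathbb{R}^p$, $\sigma>0$. *)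

theory Defs
  imports "HOL-Analysis.Analysis"
begin

(* The finite types 'o, 'm and 'p index the observed responses, the missing responses and the
   regression coefficients.  Stacked vectors and block matrices are indexed by sum types. *)

definition stack_vec :: "'a^'m \<Rightarrow> 'a^'n \<Rightarrow> 'a^('m + 'n)" where
  "stack_vec x y = (\<chi> i. case i of Inl k \<Rightarrow> x $ k | Inr k \<Rightarrow> y $ k)"

(* The block matrix with rows (A B) and (C D). *)
definition block_matrix ::
  "'a^'p^'m \<Rightarrow> 'a^'q^'m \<Rightarrow> 'a^'p^'n \<Rightarrow> 'a^'q^'n \<Rightarrow> 'a^('p + 'q)^('m + 'n)" where
  "block_matrix A B C D =
     (\<chi> i. case i of Inl k \<Rightarrow> stack_vec (A $ k) (B $ k) | Inr k \<Rightarrow> stack_vec (C $ k) (D $ k))"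

definition likelihood ::
  "real^'p^'o \<Rightarrow> real^'p^'m \<Rightarrow> real^'o \<Rightarrow> real^'p \<Rightarrow> real^'m \<Rightarrow> real \<Rightarrow> real" where
  "likelihood X\<^sub>o X\<^sub>m Y\<^sub>o \<beta> \<beta>\<^sub>m \<sigma> =
     (let n = CARD('o) + CARD('m) in
        1 / ((2 * pi) powr (real n / 2) * \<sigma> ^ n) *
        exp (- (1 / (2 * \<sigma>\<^sup>2)) *
          (norm (stack_vec Y\<^sub>o 0 - block_matrix X\<^sub>o 0 X\<^sub>m (- mat 1) *v stack_vec \<beta> \<beta>\<^sub>m))\<^sup>2))"

end

theory Submission
  imports Defs
begin

text \<open>The residual splits into the observed block \<open>Y\<^sub>o - X\<^sub>o \<beta>\<close>, which does not involve
  \<open>\<beta>\<^sub>m\<close>, and the missing block \<open>\<beta>\<^sub>m - X\<^sub>m \<beta>\<close>, which vanishes at \<open>\<beta>\<^sub>m = X\<^sub>m \<beta>\<close>.\<close>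

text \<open>Blockwise summation over the stacked index type; both the block matrix product and the
  squared norm reduce to it.\<close>

lemma sum_UNIV_Plus:
  fixes f :: "'a::finite + 'b::finite \<Rightarrow> 'c::comm_monoid_add"
  shows "sum f UNIV = (\<Sum>i\<in>UNIV. f (Inl i)) + (\<Sum>j\<in>UNIV. f (Inr j))"
  by (simp add: UNIV_Plus_UNIV[symmetric] sum.Plus comp_def del: UNIV_Plus_UNIV)

lemma block_matrix_mult_stack_vec:
  fixes A :: "'a::semiring_1^'p^'m" and D :: "'a^'q^'n"
  shows "block_matrix A B C D *v stack_vec x y = stack_vec (A *v x + B *v y) (C *v x + D *v y)"
  by (simp add: vec_eq_iff block_matrix_def stack_vec_def matrix_vector_mult_def sum_UNIV_Plus
      split: sum.split)

lemma stack_vec_diff: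
  fixes x :: "'a::ab_group_add^'m" and y :: "'a^'n"
  shows "stack_vec x y - stack_vec x' y' = stack_vec (x - x') (y - y')"
  by (simp add: vec_eq_iff stack_vec_def split: sum.split)

text \<open>Pythagoras: the two blocks occupy disjoint coordinates, so no cross term arises.\<close>

lemma norm_stack_vec_power2:
  fixes x :: "'a::real_normed_vector^'m" and y :: "'a^'n"
  shows "(norm (stack_vec x y))\<^sup>2 = (norm x)\<^sup>2 + (norm y)\<^sup>2"
  by (simp add: norm_vec_def L2_set_def sum_nonneg sum_UNIV_Plus stack_vec_def)

lemma norm_residual_power2:
  fixes X\<^sub>o :: "real^'p^'o" and X\<^sub>m :: "real^'p^'m"
  shows "(norm (stack_vec Y\<^sub>o 0 - block_matrix X\<^sub>o 0 X\<^sub>m (- mat 1) *v stack_vec \<beta> \<beta>\<^sub>m))\<^sup>2 =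
    (norm (Y\<^sub>o - X\<^sub>o *v \<beta>))\<^sup>2 + (norm (\<beta>\<^sub>m - X\<^sub>m *v \<beta>))\<^sup>2"
proof -
  \<comment> \<open>The negated identity is read as \<open>0 - mat 1\<close>, so that distributivity
    over differences applies.\<close>
  have "(- mat 1) *v \<beta>\<^sub>m = - \<beta>\<^sub>m"
    using matrix_vector_mult_diff_rdistrib[of 0 "mat 1" \<beta>\<^sub>m] by simp
  then show ?thesis
    by (simp add: block_matrix_mult_stack_vec stack_vec_diff norm_stack_vec_power2)
qed

theorem theorem1:
  fixes X\<^sub>o :: "real^'p^'o" and X\<^sub>m :: "real^'p^'m" and Y\<^sub>o :: "real^'o"
    and \<beta> :: "real^'p" and \<sigma> :: real
  assumes "\<sigma> > 0"
  shows "is_arg_max (\<lambda>\<beta>\<^sub>m. likelihood X\<^sub>o X\<^sub>m Y\<^sub>o \<beta> \<beta>\<^sub>m \<sigma>) (\<lambda>_. True) (X\<^sub>m *v \<beta>)"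
proof -
  have "likelihood X\<^sub>o X\<^sub>m Y\<^sub>o \<beta> \<beta>\<^sub>m \<sigma> \<le> likelihood X\<^sub>o X\<^sub>m Y\<^sub>o \<beta> (X\<^sub>m *v \<beta>) \<sigma>" for \<beta>\<^sub>m
    \<comment> \<open>The prefactor is nonnegative as \<sigma> > 0 and is the same on both sides.
      Only the exponents differ: the right one has lost the nonnegative square of the missing
      block.\<close>
    unfolding likelihood_def Let_def norm_residual_power2
    using assms by (intro mult_left_mono) (auto intro!: divide_right_mono)
  then show ?thesis
    by (simp add: is_arg_max_def not_less)
qed

end
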